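(* Let $k\ge 1$, let $\mathcal{X}\subseteq\mathbb{R}^k$ be compact and such that any linearly independent vectors $x_1,\ldots,x_\ell\in\mathcal{X}$ with $\ell<k$ can be completed to a linearly independent set $x_1,\ldots,x_k\in\mathcal{X}$ of size $k$, and let $c\in\mathbb{R}^k$ be nonzero. Let $\mathcal{S}=\{(x_1,\ldots,x_k)\in\mathcal{X}^k: x_1,\ldots,x_k \text{ are linearly independent}\}$, and for $(x_1,\ldots,x_k)\in\mathcal{S}$ let $\phi(x_1,\ldots,x_k)=\|z^*(x_1,\ldots,x_k)\|^2$. Let $(x_1^*,\ldots,x_k^* )\in\mathcal{S}$ attain the maximum of $\phi$ over $\mathcal{S}$, i.e. $(x_1^*,\ldots,x_k^* )=\arg\max_{\mathcal{S}}\phi$. Then the design $\xi^*(x_1^*,\ldots,x_k^* )=\{(x_i^*,p_i^* )\}_{i=1}^k$, where $p_i^*=p_i^*(x_1^*,\ldots,x_k^* )$, is $c$-optimal. (The functions $z^*$, $p_i^*$, $\xi^*$ and the notion of $c$-optimality are defined in the context.)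
   Context: Prime denotes transpose and $\|\cdot\|$ is the Euclidean norm on $\mathbb{R}^k$. A design is a probability measure $\xi$ on $\mathcal{X}$; $\{(x_i,p_i)\}_{i=1}^\ell$ (with $p_i\ge 0$, $\sum_i p_i=1$) denotes the design putting weight $p_i$ on the point $x_i$. The information matrix of a measure $\xi$ on $\mathcal{X}$ is $M(\xi)=\int_{\mathcal{X}}xx'\,\xi(dx)$, so $M(\{(x_i,p_i)\}_{i=1}^\ell)=\sum_{i=1}^\ell p_ix_ix_i'$. The class of designs for which $c'\theta$ is estimable is $$\Xi=\left\{\xi:\ \int_{\mathcal{X}}\xi(dx)=1\ \text{ and }\ c=M(\xi)d\ \text{ for some } d\in\mathbb{R}^k\right\}.$$ For $\xi\in\Xi$ put $\Psi(\xi)=c'M(\xi)^{-1}c$, where, if $M(\xi)$ is singular, $M(\xi)^{-1}$ means any generalized inverse of $M(\xi)$ (a matrix $G$ with $M(\xi)GM(\xi)=M(\xi)$); the value of $\Psi(\xi)$ does not depend on which generalized inverse is chosen. A design $\xi$ is $c$-optimal if $\xi\in\Xi$ and it attains $\min_{\xi\in\Xi}\Psi(\xi)$. For linearly independent $x_1,\ldots,x_\ell\in\mathcal{X}$, $\ell\le k$, such that $c\in\mathrm{span}(x_1,\ldots,x_\ell)$, let $M=M(\{(x_i,1/\ell)\}_{i=1}^\ell)=\ell^{-1}\sum_{i=1}^\ell x_ix_i'$, let $M^{-1}$ be any generalized inverse of $M$ (the ordinary inverse when $\ell=k$), and define, for $i=1,\ldots,\ell$, $$\varepsilon_i^*=\varepsilon_i^*(x_1,\ldots,x_\ell)=\mathrm{sign}(x_i'M^{-1}c),\qquad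 p_i^*=p_i^*(x_1,\ldots,x_\ell)=\frac{|x_i'M^{-1}c|}{\sum_{j=1}^\ell|x_j'M^{-1}c|},$$ $$\xi^*(x_1,\ldots,x_\ell)=\{(x_i,p_i^* )\}_{i=1}^\ell,\qquad z^*(x_1,\ldots,x_\ell)=\sum_{i=1}^\ell\varepsilon_i^*p_i^*x_i.$$ (The value assigned to $\mathrm{sign}(0)$ is immaterial for $\xi^*$ and $z^*$, since then $p_i^*=0$.) *)

theory Defs
  imports "HOL-Probability.Probability"
begin

section \<open>Designs and information matrices\<close>

definition outer :: "real ^ 'k \<Rightarrow> real ^ 'k ^ 'k" where
  "outer x = (\<chi> i j. x $ i * x $ j)"

definition design :: "(real ^ 'k) set \<Rightarrow> (real ^ 'k) measure \<Rightarrow> bool" where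
  "design X \<xi> \<longleftrightarrow> prob_space \<xi> \<and> sets \<xi> = sets (restrict_space borel X)"

definition info_matrix :: "(real ^ 'k) measure \<Rightarrow> real ^ 'k ^ 'k" where
  "info_matrix \<xi> = (\<integral>x. outer x \<partial>\<xi>)"

text \<open>The design putting weight \<open>p i\<close> on the point \<open>x i\<close>, for \<open>i = 1, ..., l\<close>
  (weights of coinciding points add up).  Families are functions on \<open>nat\<close> of which only the
  values on \<open>{1..l}\<close> matter.\<close>

definition finite_design ::
  "(real ^ 'k) set \<Rightarrow> nat \<Rightarrow> (nat \<Rightarrow> real ^ 'k) \<Rightarrow> (nat \<Rightarrow> real) \<Rightarrow> (real ^ 'k) measure" where
  "finite_design X l x p =
     distr (point_measure {1..l} (\<lambda>i. ennreal (p i))) (restrict_space borel X) x"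

lemma info_matrix_finite_design:
  fixes x :: "nat \<Rightarrow> real ^ 'k"
  assumes x: "x \<in> {1..l} \<rightarrow> X" and p: "\<And>i. i \<in> {1..l} \<Longrightarrow> 0 \<le> p i"
  shows "info_matrix (finite_design X l x p) = (\<Sum>i=1..l. p i *\<^sub>R outer (x i))"
proof -
  have "outer \<in> borel_measurable (borel :: (real ^ 'k) measure)"
    unfolding outer_def by (intro borel_measurable_continuous_onI continuous_intros)
  then have m: "outer \<in> borel_measurable (restrict_space (borel :: (real ^ 'k) measure) X)"
    by (rule measurable_restrict_space1)
  have "x \<in> measurable (point_measure {1..l} (\<lambda>i. ennreal (p i))) (restrict_space borel X)"
    using x by (auto simp: measurable_point_measure_eq1 space_restrict_space)
  then have "info_matrix (finite_design X l x p)
      = (\<integral>i. outer (x i) \<partial>point_measure {1..l} (\<lambda>i. ennreal (p i)))"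
    unfolding info_matrix_def finite_design_def using m by (rule integral_distr)
  also have "\<dots> = (\<Sum>i=1..l. p i *\<^sub>R outer (x i))"
    using p by (intro lebesgue_integral_point_measure_finite) auto
  finally show ?thesis .
qed


section \<open>Generalized inverses\<close>

definition is_gen_inverse :: "real ^ 'k ^ 'k \<Rightarrow> real ^ 'k ^ 'k \<Rightarrow> bool" where
  "is_gen_inverse M G \<longleftrightarrow> M ** G ** M = M"

text \<open>Any generalized inverse will do below.  One is selected by Hilbert choice; it exists, it is
  the ordinary inverse of an invertible matrix, and \<open>u \<bullet> (G *v v)\<close> does not depend on the
  choice for \<open>u\<close>, \<open>v\<close> in the range of a symmetric matrix.\<close>

definition gen_inverse :: "real ^ 'k ^ 'k \<Rightarrow> real ^ 'k ^ 'k" where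
  "gen_inverse M = (SOME G. is_gen_inverse M G)"

lemma is_gen_inverse_gen_inverse: "is_gen_inverse M (gen_inverse M)"
proof -
  have "linear ((*v) M)" by (rule matrix_vector_mul_linear)
  from linear_exists_right_inverse_on[OF this subspace_UNIV]
  obtain g where g: "linear g" "\<And>y. M *v g (M *v y) = M *v y" by auto
  have "(M ** matrix g ** M) *v y = M *v y" for y
    using g by (simp add: matrix_vector_mul_assoc[symmetric] matrix_works)
  then have "is_gen_inverse M (matrix g)"
    unfolding is_gen_inverse_def by (simp add: matrix_eq)
  then show ?thesis unfolding gen_inverse_def by (rule someI)
qed

lemma gen_inverse_eq_matrix_inv:
  assumes "invertible M"
  shows "gen_inverse M = matrix_inv M"
proof -
  let ?G = "gen_inverse M" and ?I = "matrix_inv M"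
  have I: "?I ** M = mat 1" "M ** ?I = mat 1"
    using assms unfolding matrix_inv_def invertible_def by (metis (mono_tags, lifting) someI_ex)+
  have "?I ** (M ** ?G ** M) ** ?I = ?I ** M ** ?I"
    using is_gen_inverse_gen_inverse[of M] by (simp add: is_gen_inverse_def)
  then show ?thesis
    by (metis I matrix_mul_assoc matrix_mul_lid matrix_mul_rid)
qed

lemma gen_inverse_unique:
  assumes "transpose M = M" and "is_gen_inverse M G" and "is_gen_inverse M H"
    and "u = M *v a" and "v = M *v b"
  shows "u \<bullet> (G *v v) = u \<bullet> (H *v v)"
proof -
  have *: "u \<bullet> (K *v v) = a \<bullet> (M *v b)" if "is_gen_inverse M K" for K
  proof -
    have "u \<bullet> (K *v v) = a \<bullet> (M *v (K *v (M *v b)))"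
      using assms by (metis dot_lmul_matrix vector_transpose_matrix)
    then show ?thesis
      using that by (simp add: is_gen_inverse_def matrix_vector_mul_assoc matrix_mul_assoc)
  qed
  show ?thesis by (simp add: *[OF assms(2)] *[OF assms(3)])
qed


section \<open>\<open>c\<close>-optimality\<close>

definition Xi :: "(real ^ 'k) set \<Rightarrow> real ^ 'k \<Rightarrow> (real ^ 'k) measure set" where
  "Xi X c = {\<xi>. design X \<xi> \<and> (\<exists>d. c = info_matrix \<xi> *v d)}"

definition Psi :: "real ^ 'k \<Rightarrow> (real ^ 'k) measure \<Rightarrow> real" where
  "Psi c \<xi> = c \<bullet> (gen_inverse (info_matrix \<xi>) *v c)"

definition c_optimal :: "(real ^ 'k) set \<Rightarrow> real ^ 'k \<Rightarrow> (real ^ 'k) measure \<Rightarrow> bool" where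
  "c_optimal X c \<xi> \<longleftrightarrow> \<xi> \<in> Xi X c \<and> (\<forall>\<eta>\<in>Xi X c. Psi c \<xi> \<le> Psi c \<eta>)"


section \<open>Designs on linearly independent points\<close>

definition lin_indep :: "nat \<Rightarrow> (nat \<Rightarrow> 'v::real_vector) \<Rightarrow> bool" where
  "lin_indep l x \<longleftrightarrow> inj_on x {1..l} \<and> independent (x ` {1..l})"

definition indep_points :: "(real ^ 'k) set \<Rightarrow> nat \<Rightarrow> (nat \<Rightarrow> real ^ 'k) set" where
  "indep_points X l = {x. x \<in> {1..l} \<rightarrow> X \<and> lin_indep l x}"

definition completable :: "(real ^ 'k) set \<Rightarrow> bool" where
  "completable X \<longleftrightarrow>
     (\<forall>l x. 1 \<le> l \<and> l < CARD('k) \<and> x \<in> indep_points X l \<longrightarrow>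
        (\<exists>y \<in> indep_points X CARD('k). \<forall>i\<in>{1..l}. y i = x i))"

definition unif_matrix :: "nat \<Rightarrow> (nat \<Rightarrow> real ^ 'k) \<Rightarrow> real ^ 'k ^ 'k" where
  "unif_matrix l x = (1 / real l) *\<^sub>R (\<Sum>i=1..l. outer (x i))"

lemma unif_matrix_eq_info_matrix:
  assumes "x \<in> {1..l} \<rightarrow> X"
  shows "unif_matrix l x = info_matrix (finite_design X l x (\<lambda>_. 1 / real l))"
  using info_matrix_finite_design[OF assms, of "\<lambda>_. 1 / real l"]
  by (simp add: unif_matrix_def scaleR_sum_right)

definition eps_star :: "real ^ 'k \<Rightarrow> nat \<Rightarrow> (nat \<Rightarrow> real ^ 'k) \<Rightarrow> nat \<Rightarrow> real" where
  "eps_star c l x i = sgn (x i \<bullet> (gen_inverse (unif_matrix l x) *v c))"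

definition p_star :: "real ^ 'k \<Rightarrow> nat \<Rightarrow> (nat \<Rightarrow> real ^ 'k) \<Rightarrow> nat \<Rightarrow> real" where
  "p_star c l x i = \<bar>x i \<bullet> (gen_inverse (unif_matrix l x) *v c)\<bar> /
     (\<Sum>j=1..l. \<bar>x j \<bullet> (gen_inverse (unif_matrix l x) *v c)\<bar>)"

definition xi_star ::
  "(real ^ 'k) set \<Rightarrow> real ^ 'k \<Rightarrow> nat \<Rightarrow> (nat \<Rightarrow> real ^ 'k) \<Rightarrow> (real ^ 'k) measure" where
  "xi_star X c l x = finite_design X l x (p_star c l x)"

definition z_star :: "real ^ 'k \<Rightarrow> nat \<Rightarrow> (nat \<Rightarrow> real ^ 'k) \<Rightarrow> real ^ 'k" where
  "z_star c l x = (\<Sum>i=1..l. (eps_star c l x i * p_star c l x i) *\<^sub>R x i)"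

definition phi :: "real ^ 'k \<Rightarrow> (nat \<Rightarrow> real ^ 'k) \<Rightarrow> real" where
  "phi c x = (norm (z_star c CARD('k) x))\<^sup>2"

end

theory Submission
  imports Defs
begin

text \<open>
  The theorem is Elfving's geometric description of \<open>c\<close>-optimality, combined with the existence of
  basic solutions of the linear program behind it.

  Let \<open>x\<^sub>1, \<dots>, x\<^sub>k\<close> be independent points and \<open>c = \<Sum>i. a\<^sub>i x\<^sub>i\<close>.  Then \<open>x\<^sub>i' M\<^sup>-\<^sup>1 c = k a\<^sub>i\<close>, so the
  weights \<open>p\<^sub>i\<^sup>*\<close> are \<open>|a\<^sub>i| / A\<close> with \<open>A = \<Sum>i. |a\<^sub>i|\<close>, and \<open>z\<^sup>* = c / A\<close>.  Maximizing \<open>\<phi>\<close>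
  therefore means minimizing the \<open>\<ell>\<^sub>1\<close> norm \<open>A\<close> of the coordinates of \<open>c\<close> over all bases taken from
  \<open>X\<close>.  The design \<open>\<xi>\<^sup>*\<close> has \<open>\<Psi>(\<xi>\<^sup>*) = A\<^sup>2\<close> (\<open>xi_star_in_Xi_Psi\<close>): a vector \<open>e\<close> with
  \<open>x\<^sub>i' e = A sgn a\<^sub>i\<close> solves \<open>M(\<xi>\<^sup>*) e = c\<close>.

  It remains to find, for each competing design \<open>\<eta>\<close>, a basis from \<open>X\<close> in which the \<open>\<ell>\<^sub>1\<close> norm of the
  coordinates of \<open>c\<close> is at most \<open>s = \<surd>\<Psi>(\<eta>)\<close>.  By the Cauchy--Schwarz inequality in \<open>L\<^sup>2(\<eta>)\<close>,
  \<open>|u' c|\<close> never exceeds \<open>s\<close> times the maximum of \<open>|u' x|\<close> over \<open>X\<close> (\<open>inner_power2_le_Psi\<close>), so no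
  hyperplane separates \<open>c / s\<close> from the convex hull of \<open>X \<union> -X\<close>, Elfving's set
  (\<open>scaled_vector_in_symmetric_hull\<close>).  Hence \<open>c / s\<close> is a finite signed combination of points of
  \<open>X\<close> with absolute weights summing to at most \<open>1\<close>.  An argument in the manner of Caratheodory
  makes these points independent without increasing that sum (\<open>independent_representation\<close>), and
  completability extends them to a basis, where the added points get coordinate \<open>0\<close>.
\<close>

section \<open>Coordinates along independent points\<close>

lemma lin_indep_sum_zero:
  assumes "lin_indep l x" and "(\<Sum>i=1..l. f i *\<^sub>R x i) = 0" and "i \<in> {1..l}"
  shows "f i = 0"
proof -
  let ?g = "inv_into {1..l} x"
  have inj: "inj_on x {1..l}" and ind: "independent (x ` {1..l})"
    using assms(1) by (auto simp: lin_indep_def)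
  have "(\<Sum>v\<in>x ` {1..l}. f (?g v) *\<^sub>R v) = (\<Sum>i=1..l. f i *\<^sub>R x i)"
    using inj by (simp add: sum.reindex)
  with assms(2) have "f (?g (x i)) = 0"
    using independentD[OF ind, of "x ` {1..l}" "\<lambda>v. f (?g v)" "x i"] assms(3) by auto
  with inj assms(3) show ?thesis by simp
qed

lemma lin_indep_coeffs_unique:
  assumes "lin_indep l x" and "(\<Sum>i=1..l. f i *\<^sub>R x i) = (\<Sum>i=1..l. g i *\<^sub>R x i)" and "i \<in> {1..l}"
  shows "f i = g i"
  using lin_indep_sum_zero[of l x "\<lambda>i. f i - g i" i] assms
  by (simp add: scaleR_diff_left sum_subtractf)

text \<open>Prescribing the values \<open>x i \<bullet> e\<close> on an independent family amounts to extending a linear functional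
  from a basis and representing it by an inner product.\<close>
lemma lin_indep_interpolation:
  fixes x :: "nat \<Rightarrow> 'a::euclidean_space"
  assumes "lin_indep l x"
  obtains e where "\<And>i. i \<in> {1..l} \<Longrightarrow> x i \<bullet> e = f i"
proof -
  have inj: "inj_on x {1..l}" and ind: "independent (x ` {1..l})"
    using assms by (auto simp: lin_indep_def)
  from linear_independent_extend[OF ind, of "\<lambda>v. f (inv_into {1..l} x v)"]
  obtain g :: "'a \<Rightarrow> real"
    where g: "linear g" "\<And>v. v \<in> x ` {1..l} \<Longrightarrow> g v = f (inv_into {1..l} x v)" by blast
  have "x i \<bullet> adjoint g 1 = f i" if "i \<in> {1..l}" for i
    using adjoint_works[OF g(1), of "x i" 1] g(2)[of "x i"] inj that by simp
  then show ?thesis by (rule that)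
qed

lemma lin_indep_basis_coeffs:
  fixes x :: "nat \<Rightarrow> real ^ 'k" and c :: "real ^ 'k"
  assumes "lin_indep CARD('k) x"
  obtains a where "c = (\<Sum>i=1..CARD('k). a i *\<^sub>R x i)"
proof -
  have inj: "inj_on x {1..CARD('k)}" and ind: "independent (x ` {1..CARD('k)})"
    using assms by (auto simp: lin_indep_def)
  have "UNIV \<subseteq> span (x ` {1..CARD('k)})"
    using card_image[OF inj] by (intro card_ge_dim_independent[OF _ ind]) (auto simp: dim_UNIV)
  then have "c \<in> span (x ` {1..CARD('k)})" by auto
  then obtain u where "c = (\<Sum>v\<in>x ` {1..CARD('k)}. u v *\<^sub>R v)"
    by (auto simp: span_finite)
  then have "c = (\<Sum>i=1..CARD('k). u (x i) *\<^sub>R x i)"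
    using inj by (simp add: sum.reindex)
  then show ?thesis by (rule that)
qed

section \<open>Information matrices\<close>

lemma outer_mult_vector: "outer x *v d = (x \<bullet> d) *\<^sub>R x"
  by (simp add: vec_eq_iff outer_def matrix_vector_mult_def inner_vec_def sum_distrib_left
      sum_distrib_right mult_ac)

lemma sum_matrix_vector_mult: "(\<Sum>i\<in>I. A i) *v d = (\<Sum>i\<in>I. A i *v d)"
  by (induction I rule: infinite_finite_induct) (auto simp: matrix_vector_mult_add_rdistrib)

lemma weighted_outer_mult_vector:
  "(\<Sum>i\<in>I. p i *\<^sub>R outer (x i)) *v d = (\<Sum>i\<in>I. (p i * (x i \<bullet> d)) *\<^sub>R x i)"
  by (simp add: sum_matrix_vector_mult outer_mult_vector flip: scaleR_matrix_vector_assoc)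

lemma integrable_design:
  fixes f :: "real ^ 'k \<Rightarrow> 'b::euclidean_space"
  assumes "design X \<xi>" and "compact X" and "continuous_on UNIV f"
  shows "integrable \<xi> f"
proof -
  interpret prob_space \<xi> using assms(1) by (simp add: design_def)
  have sets: "sets \<xi> = sets (restrict_space borel X)" using assms(1) by (simp add: design_def)
  have space: "space \<xi> = X" using sets_eq_imp_space_eq[OF sets] by (simp add: space_restrict_space)
  have "compact (f ` X)"
    using compact_continuous_image[OF continuous_on_subset[OF assms(3) subset_UNIV] assms(2)] .
  then have "bounded (f ` X)" by (rule compact_imp_bounded)
  then obtain B where "\<And>x. x \<in> X \<Longrightarrow> norm (f x) \<le> B"
    by (auto simp: bounded_iff)
  moreover have "f \<in> borel_measurable \<xi>"
    using measurable_restrict_space1[OF borel_measurable_continuous_onI[OF assms(3)], of X]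
      measurable_cong_sets[OF sets refl] by auto
  ultimately show ?thesis
    using space by (intro integrable_const_bound[where B = B]) auto
qed

lemma inner_info_matrix:
  fixes u v :: "real ^ 'k"
  assumes "design X \<xi>" and "compact X"
  shows "u \<bullet> (info_matrix \<xi> *v v) = (\<integral>x. (x \<bullet> u) * (x \<bullet> v) \<partial>\<xi>)"
proof -
  have "continuous_on UNIV (outer :: real ^ 'k \<Rightarrow> _)"
    unfolding outer_def by (intro continuous_intros)
  then have int: "integrable \<xi> outer" using assms by (intro integrable_design)
  have "linear (\<lambda>M :: real ^ 'k ^ 'k. u \<bullet> (M *v v))"
    by (rule linearI)
      (simp_all add: matrix_vector_mult_add_rdistrib inner_add_right flip: scaleR_matrix_vector_assoc)
  then have "bounded_linear (\<lambda>M :: real ^ 'k ^ 'k. u \<bullet> (M *v v))"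
    by (simp add: linear_conv_bounded_linear)
  from integral_bounded_linear[OF this int] show ?thesis
    by (simp add: info_matrix_def outer_mult_vector inner_commute mult.commute)
qed

lemma info_matrix_symmetric:
  assumes "design X \<xi>" and "compact X"
  shows "u \<bullet> (info_matrix \<xi> *v v) = v \<bullet> (info_matrix \<xi> *v u)"
  by (simp add: inner_info_matrix[OF assms] mult.commute)

lemma gen_inverse_cancel: "M *v (gen_inverse M *v (M *v d)) = M *v d"
  using is_gen_inverse_gen_inverse[of M]
  by (simp add: is_gen_inverse_def matrix_vector_mul_assoc matrix_mul_assoc)

text \<open>Writing \<open>M\<close> for the information matrix and \<open>G\<close> for the chosen generalized inverse, symmetry of \<open>M\<close>
  gives \<open>c \<bullet> G c = d \<bullet> M G M d = d \<bullet> M d\<close>.  Any solution \<open>d\<close> of \<open>M d = c\<close> thus replaces the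
  generalized inverse in all later computations.\<close>
lemma Psi_eq_inner:
  assumes "design X \<xi>" and "compact X" and c: "c = info_matrix \<xi> *v d"
  shows "Psi c \<xi> = c \<bullet> d"
proof -
  let ?M = "info_matrix \<xi>" and ?G = "gen_inverse (info_matrix \<xi>)"
  have "Psi c \<xi> = (?M *v d) \<bullet> (?G *v (?M *v d))" by (simp add: Psi_def c)
  also have "\<dots> = d \<bullet> (?M *v (?G *v (?M *v d)))"
    using info_matrix_symmetric[OF assms(1,2), of "?G *v (?M *v d)" d] by (simp only: inner_commute)
  also have "\<dots> = c \<bullet> d" by (simp add: gen_inverse_cancel c inner_commute)
  finally show ?thesis .
qed

lemma design_finite_design:
  assumes "x \<in> {1..l} \<rightarrow> X" and "\<And>i. i \<in> {1..l} \<Longrightarrow> 0 \<le> p i" and "(\<Sum>i=1..l. p i) = 1"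
  shows "design X (finite_design X l x p)"
proof -
  let ?P = "point_measure {1..l} (\<lambda>i. ennreal (p i))"
  have "emeasure ?P (space ?P) = (\<Sum>i=1..l. ennreal (p i))"
    by (simp add: emeasure_point_measure_finite space_point_measure)
  also have "\<dots> = 1" using assms by (subst sum_ennreal) auto
  finally have "prob_space ?P" by (rule prob_spaceI)
  moreover have "x \<in> measurable ?P (restrict_space borel X)"
    using assms(1) by (auto simp: measurable_point_measure_eq1 space_restrict_space)
  ultimately show ?thesis
    by (simp add: design_def finite_design_def prob_space.prob_space_distr)
qed

section \<open>The design on a given independent family\<close>

text \<open>Up to the factor \<open>l\<close>, the quantities \<open>x\<^sub>i' M\<^sup>-\<^sup>1 c\<close> are the coordinates of \<open>c\<close>: since \<open>c\<close> lies in the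
  range of \<open>M\<close>, the vector \<open>w = M\<^sup>-\<^sup>1 c\<close> satisfies \<open>c = M w = \<Sum>i. (x\<^sub>i' w / l) x\<^sub>i\<close>, and coordinates
  along independent points are unique.\<close>
lemma inner_gen_inverse_unif_matrix:
  assumes "lin_indep l x" and c: "c = (\<Sum>i=1..l. a i *\<^sub>R x i)" and "i \<in> {1..l}"
  shows "x i \<bullet> (gen_inverse (unif_matrix l x) *v c) = real l * a i"
proof -
  let ?M = "unif_matrix l x"
  have l: "real l > 0" using assms(3) by auto
  have M: "?M *v e = (\<Sum>i=1..l. ((x i \<bullet> e) / real l) *\<^sub>R x i)" for e
    by (simp add: unif_matrix_def sum_matrix_vector_mult outer_mult_vector scaleR_sum_right
        flip: scaleR_matrix_vector_assoc)
  obtain e where e: "\<And>i. i \<in> {1..l} \<Longrightarrow> x i \<bullet> e = real l * a i"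
    using lin_indep_interpolation[OF assms(1), of "\<lambda>i. real l * a i"] by blast
  have "?M *v e = c" using l by (simp add: M c e)
  then have "?M *v (gen_inverse ?M *v c) = c" using gen_inverse_cancel[of ?M e] by simp
  then have "(\<Sum>i=1..l. ((x i \<bullet> (gen_inverse ?M *v c)) / real l) *\<^sub>R x i) = (\<Sum>i=1..l. a i *\<^sub>R x i)"
    by (simp only: M) (simp add: c)
  from lin_indep_coeffs_unique[OF assms(1) this assms(3)] l show ?thesis
    by (simp add: field_simps)
qed

lemma p_star_eq:
  assumes "lin_indep l x" and "c = (\<Sum>i=1..l. a i *\<^sub>R x i)" and "i \<in> {1..l}"
  shows "p_star c l x i = \<bar>a i\<bar> / (\<Sum>j=1..l. \<bar>a j\<bar>)"
  using assms(3)
  by (auto simp: p_star_def inner_gen_inverse_unif_matrix[OF assms(1,2)] abs_mult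
      simp flip: sum_distrib_left)

lemma z_star_eq:
  assumes "lin_indep l x" and c: "c = (\<Sum>i=1..l. a i *\<^sub>R x i)"
  shows "z_star c l x = (1 / (\<Sum>j=1..l. \<bar>a j\<bar>)) *\<^sub>R c"
proof -
  have "eps_star c l x i * p_star c l x i = a i / (\<Sum>j=1..l. \<bar>a j\<bar>)" if i: "i \<in> {1..l}" for i
  proof -
    have "eps_star c l x i = sgn (a i)"
      using i by (simp add: eps_star_def inner_gen_inverse_unif_matrix[OF assms i] sgn_mult)
    then show ?thesis by (simp add: p_star_eq[OF assms i] sgn_mult_abs)
  qed
  then have "z_star c l x = (\<Sum>i=1..l. (a i / (\<Sum>j=1..l. \<bar>a j\<bar>)) *\<^sub>R x i)"
    by (simp add: z_star_def)
  then show ?thesis by (simp add: c scaleR_sum_right)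
qed

lemma sum_abs_coeffs_pos:
  fixes c :: "'a::real_vector"
  assumes "c = (\<Sum>i\<in>I. a i *\<^sub>R x i)" and "c \<noteq> 0"
  shows "0 < (\<Sum>i\<in>I. \<bar>a i :: real\<bar>)"
proof (rule ccontr)
  assume neg: "\<not> ?thesis"
  have "finite I" using assms sum.infinite by metis
  moreover have "(\<Sum>i\<in>I. \<bar>a i\<bar>) = 0" using neg sum_abs_ge_zero[of a I] by linarith
  ultimately have "\<forall>i\<in>I. a i = 0" by (simp add: sum_nonneg_eq_0_iff)
  then have "(\<Sum>i\<in>I. a i *\<^sub>R x i) = 0" by (intro sum.neutral) auto
  with assms show False by simp
qed

text \<open>The weights \<open>|a\<^sub>i| / A\<close>, where \<open>A = \<Sum>i. |a\<^sub>i|\<close>, turn a vector \<open>e\<close> with \<open>x\<^sub>i \<bullet> e = A sgn a\<^sub>i\<close> into a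
  solution of \<open>M e = c\<close>; then \<open>\<Psi> = c \<bullet> e = \<Sum>i. a\<^sub>i A sgn a\<^sub>i = A\<^sup>2\<close>.\<close>
lemma xi_star_in_Xi_Psi:
  fixes x :: "nat \<Rightarrow> real ^ 'k"
  assumes X: "compact X" and x: "x \<in> indep_points X l"
    and c: "c = (\<Sum>i=1..l. a i *\<^sub>R x i)" and "c \<noteq> 0"
  shows "xi_star X c l x \<in> Xi X c" and "Psi c (xi_star X c l x) = (\<Sum>i=1..l. \<bar>a i\<bar>)\<^sup>2"
proof -
  define A where "A = (\<Sum>i=1..l. \<bar>a i\<bar>)"
  have ind: "lin_indep l x" and xX: "x \<in> {1..l} \<rightarrow> X" using x by (auto simp: indep_points_def)
  have A: "A > 0" unfolding A_def using c \<open>c \<noteq> 0\<close> by (rule sum_abs_coeffs_pos)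
  have p: "p_star c l x i = \<bar>a i\<bar> / A" if "i \<in> {1..l}" for i
    using p_star_eq[OF ind c that] by (simp add: A_def)
  have p0: "p_star c l x i \<ge> 0" if "i \<in> {1..l}" for i using p[OF that] A by simp
  have "(\<Sum>i=1..l. p_star c l x i) = A / A"
    unfolding A_def sum_divide_distrib using p by (intro sum.cong) (auto simp: A_def)
  then have des: "design X (xi_star X c l x)"
    unfolding xi_star_def using xX p0 A by (intro design_finite_design) auto
  obtain e where e: "\<And>i. i \<in> {1..l} \<Longrightarrow> x i \<bullet> e = A * sgn (a i)"
    using lin_indep_interpolation[OF ind, of "\<lambda>i. A * sgn (a i)"] by blast
  have "info_matrix (xi_star X c l x) *v e = (\<Sum>i=1..l. (p_star c l x i * (x i \<bullet> e)) *\<^sub>R x i)"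
    unfolding xi_star_def
    by (subst info_matrix_finite_design[OF xX]) (simp_all add: p0 weighted_outer_mult_vector)
  also have "\<dots> = (\<Sum>i=1..l. a i *\<^sub>R x i)"
    using A by (intro sum.cong) (auto simp: p e abs_mult_sgn)
  finally have M: "c = info_matrix (xi_star X c l x) *v e" using c by simp
  then show "xi_star X c l x \<in> Xi X c" using des by (auto simp: Xi_def)
  have "Psi c (xi_star X c l x) = c \<bullet> e" by (rule Psi_eq_inner[OF des X M])
  also have "\<dots> = (\<Sum>i=1..l. a i * (x i \<bullet> e))" by (simp add: c inner_sum_left)
  also have "\<dots> = (\<Sum>i=1..l. A * \<bar>a i\<bar>)"
    by (intro sum.cong) (auto simp: e abs_sgn mult_ac)
  also have "\<dots> = (\<Sum>i=1..l. \<bar>a i\<bar>)\<^sup>2"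
    by (simp add: A_def power2_eq_square flip: sum_distrib_left)
  finally show "Psi c (xi_star X c l x) = (\<Sum>i=1..l. \<bar>a i\<bar>)\<^sup>2" .
qed

section \<open>Short representations from the symmetric hull\<close>

text \<open>As long as the points are dependent, move the coefficients along a linear relation \<open>w\<close>, signed so
  that the \<open>\<ell>\<^sub>1\<close> norm does not grow, and stop when the first coefficient reaches \<open>0\<close>.  Up to that
  moment no coefficient changes sign, so the norm is an affine function of the step length.  The
  vanished point is dropped and the argument repeats on a smaller set.\<close>
lemma independent_representation:
  fixes y :: "'a::real_vector" and b :: "'a \<Rightarrow> real"
  assumes "finite F" and "y = (\<Sum>x\<in>F. b x *\<^sub>R x)"
  shows "\<exists>B a. B \<subseteq> F \<and> independent B \<and> y = (\<Sum>x\<in>B. a x *\<^sub>R x) \<and>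
    (\<Sum>x\<in>B. \<bar>a x\<bar>) \<le> (\<Sum>x\<in>F. \<bar>b x\<bar>)"
  using assms
proof (induction F arbitrary: b rule: finite_psubset_induct)
  case (psubset F)
  have drop: ?case if x0: "x0 \<in> F" "b' x0 = 0" and y: "y = (\<Sum>x\<in>F. b' x *\<^sub>R x)"
    and le: "(\<Sum>x\<in>F. \<bar>b' x\<bar>) \<le> (\<Sum>x\<in>F. \<bar>b x\<bar>)" for x0 and b' :: "'a \<Rightarrow> real"
  proof -
    have 1: "F - {x0} \<subset> F" using x0 by auto
    have 2: "y = (\<Sum>x\<in>F - {x0}. b' x *\<^sub>R x)"
      using y x0 psubset.hyps by (simp add: sum.remove[of F x0])
    have "(\<Sum>x\<in>F - {x0}. \<bar>b' x\<bar>) \<le> (\<Sum>x\<in>F. \<bar>b x\<bar>)"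
      using le x0 psubset.hyps by (simp add: sum.remove[of F x0 "\<lambda>x. \<bar>b' x\<bar>"])
    moreover obtain B a where "B \<subseteq> F - {x0}" "independent B" "y = (\<Sum>x\<in>B. a x *\<^sub>R x)"
      "(\<Sum>x\<in>B. \<bar>a x\<bar>) \<le> (\<Sum>x\<in>F - {x0}. \<bar>b' x\<bar>)"
      using psubset.IH[OF 1 2] by blast
    ultimately show ?thesis by (intro exI[of _ B] exI[of _ a]) auto
  qed
  show ?case
  proof (cases "independent F")
    case True
    then show ?thesis using psubset.prems by blast
  next
    case False
    then obtain w0 where w0: "(\<Sum>x\<in>F. w0 x *\<^sub>R x) = 0" "\<exists>x\<in>F. w0 x \<noteq> (0::real)"
      using psubset.hyps by (auto simp: dependent_finite)
    define w where "w = (if (\<Sum>x\<in>F. sgn (b x) * w0 x) \<le> 0 then w0 else (\<lambda>x. - w0 x))"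
    have w: "(\<Sum>x\<in>F. w x *\<^sub>R x) = 0" "\<exists>x\<in>F. w x \<noteq> 0" "(\<Sum>x\<in>F. sgn (b x) * w x) \<le> 0"
      using w0 by (auto simp: w_def sum_negf)
    show ?thesis
    proof (cases "\<exists>x\<in>F. b x = 0")
      case True
      then show ?thesis using drop[of _ b] psubset.prems by auto
    next
      case nz: False
      \<comment> \<open>the points whose coefficients shrink in absolute value when moving along \<open>w\<close>\<close>
      define N where "N = {x \<in> F. sgn (b x) * w x < 0}"
      have finN: "finite N" using psubset.hyps by (simp add: N_def)
      have "N \<noteq> {}"
      proof
        assume "N = {}"
        then have "\<forall>x\<in>F. sgn (b x) * w x \<ge> 0" by (auto simp: N_def not_less)
        with w(3) have "\<forall>x\<in>F. sgn (b x) * w x = 0"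
          using psubset.hyps by (metis (no_types, lifting) order_antisym sum_nonneg sum_nonneg_eq_0_iff)
        with nz w(2) show False by (auto simp: sgn_zero_iff)
      qed
      \<comment> \<open>the step length at which the first of these coefficients vanishes\<close>
      define t where "t = Min ((\<lambda>x. \<bar>b x\<bar> / \<bar>w x\<bar>) ` N)"
      have "t \<in> (\<lambda>x. \<bar>b x\<bar> / \<bar>w x\<bar>) ` N"
        unfolding t_def using finN \<open>N \<noteq> {}\<close> by (intro Min_in) auto
      then obtain x0 where x0: "x0 \<in> N" "t = \<bar>b x0\<bar> / \<bar>w x0\<bar>" by auto
      have t0: "t \<ge> 0" by (simp add: x0(2))
      have tle: "t \<le> \<bar>b x\<bar> / \<bar>w x\<bar>" if "x \<in> N" for x
        unfolding t_def using finN that by (intro Min_le) auto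
      define b' where "b' x = b x + t * w x" for x
      have abs_b': "\<bar>b' x\<bar> = \<bar>b x\<bar> + t * (sgn (b x) * w x)" if x: "x \<in> F" for x
      proof -
        have bx: "b x \<noteq> 0" using nz x by auto
        have "0 \<le> \<bar>b x\<bar> + t * (sgn (b x) * w x)"
        proof (cases "x \<in> N")
          case True
          then have s: "sgn (b x) * w x < 0" by (simp add: N_def)
          then have "w x \<noteq> 0" by auto
          moreover have "\<bar>sgn (b x) * w x\<bar> = \<bar>w x\<bar>" using bx by (simp add: abs_mult abs_sgn_eq)
          ultimately have "t * \<bar>w x\<bar> \<le> \<bar>b x\<bar>" "sgn (b x) * w x = - \<bar>w x\<bar>"
            using tle[OF True] s by (simp_all add: field_simps)
          then show ?thesis by simp
        next
          case False
          then show ?thesis using x t0 by (simp add: N_def not_less)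
        qed
        also have eq: "\<bar>b x\<bar> + t * (sgn (b x) * w x) = sgn (b x) * b' x"
          by (simp add: b'_def abs_sgn algebra_simps)
        finally have "\<bar>sgn (b x) * b' x\<bar> = sgn (b x) * b' x" by simp
        then show ?thesis using bx eq by (simp add: abs_mult abs_sgn_eq)
      qed
      show ?thesis
      proof (rule drop)
        show "x0 \<in> F" using x0 by (simp add: N_def)
        have s: "sgn (b x0) * w x0 < 0" using x0 by (simp add: N_def)
        then show "b' x0 = 0"
          by (auto simp: b'_def x0(2) sgn_if abs_if mult_less_0_iff split: if_splits)
        show "y = (\<Sum>x\<in>F. b' x *\<^sub>R x)"
          using w(1) psubset.prems
          by (simp add: b'_def scaleR_add_left sum.distrib flip: scaleR_scaleR scaleR_sum_right)
        have "(\<Sum>x\<in>F. \<bar>b' x\<bar>) = (\<Sum>x\<in>F. \<bar>b x\<bar>) + t * (\<Sum>x\<in>F. sgn (b x) * w x)"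
          by (simp add: abs_b' sum.distrib sum_distrib_left)
        then show "(\<Sum>x\<in>F. \<bar>b' x\<bar>) \<le> (\<Sum>x\<in>F. \<bar>b x\<bar>)"
          using w(3) t0 by (simp add: mult_nonneg_nonpos)
      qed
    qed
  qed
qed

text \<open>A point \<open>-x\<close> with weight \<open>p\<close> is read as \<open>x\<close> with coefficient \<open>-p\<close>.  A convex combination may use
  both \<open>x\<close> and \<open>-x\<close>; their coefficients are then added, which can only lower the \<open>\<ell>\<^sub>1\<close> norm.\<close>
lemma symmetric_hull_representation:
  fixes y :: "'a::real_vector"
  assumes "y \<in> convex hull (X \<union> uminus ` X)"
  shows "\<exists>B a. finite B \<and> B \<subseteq> X \<and> independent B \<and> y = (\<Sum>x\<in>B. a x *\<^sub>R x) \<and>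
    (\<Sum>x\<in>B. \<bar>a x\<bar>) \<le> (1::real)"
proof -
  obtain S U where S: "finite S" "S \<subseteq> X \<union> uminus ` X" and U: "\<And>z. z \<in> S \<Longrightarrow> 0 \<le> U z"
    "sum U S = 1" "y = (\<Sum>z\<in>S. U z *\<^sub>R z)"
    using assms unfolding convex_hull_explicit by blast
  define r where "r z = (if z \<in> X then z else - z)" for z
  define e :: "'a \<Rightarrow> real" where "e z = (if z \<in> X then 1 else - 1)" for z
  have r: "r ` S \<subseteq> X" using S by (auto simp: r_def)
  define b where "b x = (\<Sum>z\<in>{z \<in> S. r z = x}. U z * e z)" for x
  have "y = (\<Sum>z\<in>S. (U z * e z) *\<^sub>R r z)"
    unfolding U(3) by (intro sum.cong) (auto simp: r_def e_def)
  also have "\<dots> = (\<Sum>x\<in>r ` S. \<Sum>z\<in>{z \<in> S. r z = x}. (U z * e z) *\<^sub>R r z)"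
    using S(1) by (rule sum.image_gen)
  also have "\<dots> = (\<Sum>x\<in>r ` S. b x *\<^sub>R x)"
    by (simp add: b_def scaleR_sum_left)
  finally have y: "y = (\<Sum>x\<in>r ` S. b x *\<^sub>R x)" .
  have "(\<Sum>x\<in>r ` S. \<bar>b x\<bar>) \<le> (\<Sum>x\<in>r ` S. \<Sum>z\<in>{z \<in> S. r z = x}. U z)"
  proof (rule sum_mono)
    fix x
    have "\<bar>b x\<bar> \<le> (\<Sum>z\<in>{z \<in> S. r z = x}. \<bar>U z * e z\<bar>)" unfolding b_def by (rule sum_abs)
    also have "\<dots> = (\<Sum>z\<in>{z \<in> S. r z = x}. U z)"
      using U(1) by (intro sum.cong) (auto simp: e_def)
    finally show "\<bar>b x\<bar> \<le> (\<Sum>z\<in>{z \<in> S. r z = x}. U z)" .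
  qed
  also have "\<dots> = 1" using sum.image_gen[OF S(1), of U r] U(2) by simp
  finally have b: "(\<Sum>x\<in>r ` S. \<bar>b x\<bar>) \<le> 1" .
  have fin: "finite (r ` S)" using S(1) by simp
  obtain B a where "B \<subseteq> r ` S" "independent B" "y = (\<Sum>x\<in>B. a x *\<^sub>R x)"
    "(\<Sum>x\<in>B. \<bar>a x\<bar>) \<le> (\<Sum>x\<in>r ` S. \<bar>b x\<bar>)"
    using independent_representation[OF fin y] by blast
  then show ?thesis
    using b r finite_subset[OF _ fin] by (intro exI[of _ B] exI[of _ a]) auto
qed

section \<open>The lower bound for an arbitrary design\<close>

text \<open>If \<open>c = M(\<eta>) d\<close>, then \<open>u \<bullet> c\<close> is the \<open>L\<^sup>2(\<eta>)\<close> inner product of the functions \<open>x \<bullet> u\<close> and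
  \<open>x \<bullet> d\<close>.  The latter has squared norm \<open>\<Psi>(\<eta>)\<close> and the former at most \<open>m\<^sup>2\<close>, because \<open>\<eta>\<close> is a
  probability measure.  The claim is the Cauchy--Schwarz inequality, obtained here from a quadratic
  form that is nonnegative because it bounds the integral of a square.\<close>
lemma inner_power2_le_Psi:
  fixes u c :: "real ^ 'k"
  assumes X: "compact X" and \<eta>: "\<eta> \<in> Xi X c" and m: "\<And>x. x \<in> X \<Longrightarrow> \<bar>x \<bullet> u\<bar> \<le> m"
  shows "(u \<bullet> c)\<^sup>2 \<le> m\<^sup>2 * Psi c \<eta>"
proof -
  obtain d where des: "design X \<eta>" and c: "c = info_matrix \<eta> *v d" using \<eta> by (auto simp: Xi_def)
  interpret prob_space \<eta> using des by (simp add: design_def)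
  have sets: "sets \<eta> = sets (restrict_space borel X)" using des by (simp add: design_def)
  have space: "space \<eta> = X" using sets_eq_imp_space_eq[OF sets] by (simp add: space_restrict_space)
  have int: "integrable \<eta> (\<lambda>x. (x \<bullet> v) * (x \<bullet> w))" for v w
    by (rule integrable_design[OF des X]) (intro continuous_intros)
  have P: "Psi c \<eta> = (\<integral>x. (x \<bullet> d) * (x \<bullet> d) \<partial>\<eta>)"
    using Psi_eq_inner[OF des X c] inner_info_matrix[OF des X, of d d] by (simp add: c inner_commute)
  have uc: "u \<bullet> c = (\<integral>x. (x \<bullet> u) * (x \<bullet> d) \<partial>\<eta>)"
    by (simp add: c inner_info_matrix[OF des X])
  have uu: "(\<integral>x. (x \<bullet> u) * (x \<bullet> u) \<partial>\<eta>) \<le> m\<^sup>2"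
  proof (rule integral_le_const[OF int])
    show "AE x in \<eta>. (x \<bullet> u) * (x \<bullet> u) \<le> m\<^sup>2"
    proof (rule AE_I2)
      fix x assume "x \<in> space \<eta>"
      then have "\<bar>x \<bullet> u\<bar>\<^sup>2 \<le> m\<^sup>2" using m space by (intro power_mono) auto
      then show "(x \<bullet> u) * (x \<bullet> u) \<le> m\<^sup>2" by (simp add: power2_eq_square)
    qed
  qed
  have quad: "0 \<le> s\<^sup>2 * m\<^sup>2 - 2 * s * t * (u \<bullet> c) + t\<^sup>2 * Psi c \<eta>" for s t
  proof -
    have "0 \<le> (\<integral>x. (x \<bullet> (s *\<^sub>R u - t *\<^sub>R d)) * (x \<bullet> (s *\<^sub>R u - t *\<^sub>R d)) \<partial>\<eta>)"
      by (intro integral_nonneg_AE) auto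
    also have "\<dots> = (\<integral>x. s\<^sup>2 * ((x \<bullet> u) * (x \<bullet> u)) - 2 * s * t * ((x \<bullet> u) * (x \<bullet> d))
        + t\<^sup>2 * ((x \<bullet> d) * (x \<bullet> d)) \<partial>\<eta>)"
      by (intro Bochner_Integration.integral_cong refl)
        (simp add: inner_diff_right power2_eq_square algebra_simps)
    also have "\<dots> = s\<^sup>2 * (\<integral>x. (x \<bullet> u) * (x \<bullet> u) \<partial>\<eta>) - 2 * s * t * (u \<bullet> c) + t\<^sup>2 * Psi c \<eta>"
      using int by (simp add: P uc)
    also have "\<dots> \<le> s\<^sup>2 * m\<^sup>2 - 2 * s * t * (u \<bullet> c) + t\<^sup>2 * Psi c \<eta>"
      using uu by (simp add: mult_left_mono)
    finally show ?thesis .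
  qed
  have P0: "0 \<le> Psi c \<eta>" using quad[of 0 1] by simp
  show ?thesis
  proof (cases "Psi c \<eta> = 0")
    case True
    have "u \<bullet> c = 0"
    proof (rule ccontr)
      assume "u \<bullet> c \<noteq> 0"
      \<comment> \<open>the form is now affine in \<open>t\<close>, and this \<open>t\<close> gives it the value \<open>- 1\<close>\<close>
      then show False using quad[of 1 "(m\<^sup>2 + 1) / (2 * (u \<bullet> c))"] True by simp
    qed
    then show ?thesis by (simp add: True)
  next
    case False
    have "0 \<le> Psi c \<eta> * (Psi c \<eta> * m\<^sup>2 - (u \<bullet> c)\<^sup>2)"
      using quad[of "Psi c \<eta>" "u \<bullet> c"] by (simp add: power2_eq_square algebra_simps)
    then show ?thesis using P0 False by (simp add: zero_le_mult_iff mult.commute)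
  qed
qed

text \<open>The preceding inequality with \<open>u = c\<close> has the positive left-hand side \<open>(c \<bullet> c)\<^sup>2\<close>.\<close>
lemma Psi_pos:
  assumes "compact X" and "\<eta> \<in> Xi X c" and "c \<noteq> 0"
  shows "0 < Psi c \<eta>"
proof -
  have "compact ((\<lambda>x. x \<bullet> c) ` X)"
    using assms(1) by (intro compact_continuous_image continuous_intros)
  then obtain m where "\<And>x. x \<in> X \<Longrightarrow> \<bar>x \<bullet> c\<bar> \<le> m"
    using compact_imp_bounded[of "(\<lambda>x. x \<bullet> c) ` X"] by (auto simp: bounded_real)
  then have "(c \<bullet> c)\<^sup>2 \<le> m\<^sup>2 * Psi c \<eta>" by (rule inner_power2_le_Psi[OF assms(1,2)])
  moreover have "0 < (c \<bullet> c)\<^sup>2" using assms(3) by simp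
  ultimately have "0 < m\<^sup>2 * Psi c \<eta>" by linarith
  then show ?thesis by (simp add: zero_less_mult_iff)
qed

text \<open>The convex hull of \<open>X \<union> -X\<close> is compact and symmetric, so a hyperplane strictly separating
  \<open>c / \<surd>\<Psi>(\<eta>)\<close> from it would have a normal \<open>u\<close> with \<open>|x \<bullet> u| \<le> b\<close> on \<open>X\<close> and
  \<open>|u \<bullet> c| > b \<surd>\<Psi>(\<eta>)\<close>, contradicting
  \<open>inner_power2_le_Psi\<close>.\<close>
lemma scaled_vector_in_symmetric_hull:
  assumes "compact X" and "\<eta> \<in> Xi X c" and "c \<noteq> 0"
  shows "(1 / sqrt (Psi c \<eta>)) *\<^sub>R c \<in> convex hull (X \<union> uminus ` X)" (is "?z \<in> ?R")
proof (rule ccontr)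
  assume "?z \<notin> ?R"
  moreover have "closed ?R"
    using assms(1) by (intro compact_imp_closed compact_convex_hull compact_Un compact_negations)
  ultimately obtain u m where um: "u \<bullet> ?z < m" "\<And>y. y \<in> ?R \<Longrightarrow> m < u \<bullet> y"
    using separating_hyperplane_closed_point[OF convex_convex_hull] by blast
  have x: "\<bar>x \<bullet> u\<bar> \<le> - m" if "x \<in> X" for x
    using um(2)[OF hull_inc, of x] um(2)[OF hull_inc, of "- x"] that by (auto simp: inner_commute)
  have P: "0 < Psi c \<eta>" by (rule Psi_pos[OF assms])
  obtain x where "x \<in> X"
  proof -
    obtain d where des: "design X \<eta>" using assms(2) by (auto simp: Xi_def)
    then have "space \<eta> \<noteq> {}" by (simp add: design_def prob_space.not_empty)
    moreover have "space \<eta> = X"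
      using des sets_eq_imp_space_eq[of \<eta>] by (auto simp: design_def space_restrict_space)
    ultimately show ?thesis using that by auto
  qed
  \<comment> \<open>the bound \<open>b\<close> is \<open>- m\<close>, since \<open>u\<close> points towards the hull\<close>
  with x have m: "m \<le> 0" by fastforce
  have "(u \<bullet> c)\<^sup>2 \<le> (- m)\<^sup>2 * Psi c \<eta>" by (rule inner_power2_le_Psi[OF assms(1,2) x])
  also have "\<dots> = (- m * sqrt (Psi c \<eta>))\<^sup>2" using P by (simp add: power_mult_distrib)
  finally have "\<bar>u \<bullet> c\<bar> \<le> \<bar>- m * sqrt (Psi c \<eta>)\<bar>" by (simp only: abs_le_square_iff)
  also have "\<dots> = - m * sqrt (Psi c \<eta>)"
    using m P by (intro abs_of_nonneg mult_nonneg_nonneg) auto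
  finally have "\<bar>u \<bullet> c\<bar> \<le> - m * sqrt (Psi c \<eta>)" .
  moreover have "u \<bullet> c / sqrt (Psi c \<eta>) < m" using um(1) by simp
  then have "u \<bullet> c < m * sqrt (Psi c \<eta>)" using P by (subst (asm) pos_divide_less_eq) auto
  ultimately show False by linarith
qed

lemma independent_representation_le_Psi:
  assumes "compact X" and "\<eta> \<in> Xi X c" and "c \<noteq> 0"
  shows "\<exists>B a. finite B \<and> B \<subseteq> X \<and> independent B \<and> c = (\<Sum>x\<in>B. a x *\<^sub>R x) \<and>
    (\<Sum>x\<in>B. \<bar>a x\<bar>)\<^sup>2 \<le> Psi c \<eta>"
proof -
  let ?s = "sqrt (Psi c \<eta>)"
  have P: "0 < Psi c \<eta>" by (rule Psi_pos[OF assms])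
  obtain B a where B: "finite B" "B \<subseteq> X" "independent B"
    and a: "(1 / ?s) *\<^sub>R c = (\<Sum>x\<in>B. a x *\<^sub>R x)" "(\<Sum>x\<in>B. \<bar>a x\<bar>) \<le> 1"
    using symmetric_hull_representation[OF scaled_vector_in_symmetric_hull[OF assms]] by blast
  have "c = ?s *\<^sub>R ((1 / ?s) *\<^sub>R c)" using P by simp
  also have "\<dots> = (\<Sum>x\<in>B. (?s * a x) *\<^sub>R x)" unfolding a(1) by (simp add: scaleR_sum_right)
  finally have c: "c = (\<Sum>x\<in>B. (?s * a x) *\<^sub>R x)" .
  have "(\<Sum>x\<in>B. \<bar>?s * a x\<bar>)\<^sup>2 = Psi c \<eta> * (\<Sum>x\<in>B. \<bar>a x\<bar>)\<^sup>2"
    using P by (simp add: abs_mult power_mult_distrib flip: sum_distrib_left)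
  also have "\<dots> \<le> Psi c \<eta>"
    using P power_mono[OF a(2), of 2] by (simp add: mult_left_le sum_nonneg)
  finally show ?thesis
    using B c by (intro exI[of _ B] exI[of _ "\<lambda>x. ?s * a x"] conjI)
qed

text \<open>The points that completability adds to \<open>B\<close> receive the coefficient \<open>0\<close>, so the \<open>\<ell>\<^sub>1\<close> norm stays
  the same.\<close>
lemma complete_representation:
  fixes B :: "(real ^ 'k) set"
  assumes "completable X" and B: "finite B" "B \<subseteq> X" "independent B"
    and c: "c = (\<Sum>x\<in>B. b x *\<^sub>R x)" and "c \<noteq> 0"
  shows "\<exists>y\<in>indep_points X CARD('k). \<exists>a. c = (\<Sum>i=1..CARD('k). a i *\<^sub>R y i) \<and>
    (\<Sum>i=1..CARD('k). \<bar>a i\<bar>) = (\<Sum>x\<in>B. \<bar>b x\<bar>)"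
proof -
  define l where "l = card B"
  obtain x where bij: "bij_betw x {1..l} B"
    using ex_bij_betw_nat_finite_1[OF B(1)] unfolding l_def by blast
  have x: "x \<in> indep_points X l"
    using bij B by (auto simp: indep_points_def lin_indep_def bij_betw_def)
  have "l \<noteq> 0" using c \<open>c \<noteq> 0\<close> B(1) by (auto simp: l_def)
  have le: "l \<le> CARD('k)"
    using independent_bound[OF B(3)] by (simp add: l_def)
  obtain y where y: "y \<in> indep_points X CARD('k)" "\<And>i. i \<in> {1..l} \<Longrightarrow> y i = x i"
  proof (cases "l = CARD('k)")
    case True
    then show ?thesis using x that by blast
  next
    case False
    then show ?thesis
      using that assms(1) x le \<open>l \<noteq> 0\<close> unfolding completable_def
      by (metis One_nat_def Suc_leI le_neq_implies_less not_gr_zero)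
  qed
  define a where "a i = (if i \<le> l then b (y i) else 0)" for i
  have yB: "bij_betw y {1..l} B" using bij y(2) bij_betw_cong[of "{1..l}" y x B] by blast
  have "(\<Sum>i=1..CARD('k). a i *\<^sub>R y i) = (\<Sum>i=1..l. b (y i) *\<^sub>R y i)"
    using le by (intro sum.mono_neutral_cong_right) (auto simp: a_def)
  also have "\<dots> = c" unfolding c by (rule sum.reindex_bij_betw[OF yB])
  finally have 1: "c = (\<Sum>i=1..CARD('k). a i *\<^sub>R y i)" ..
  have "(\<Sum>i=1..CARD('k). \<bar>a i\<bar>) = (\<Sum>i=1..l. \<bar>b (y i)\<bar>)"
    using le by (intro sum.mono_neutral_cong_right) (auto simp: a_def)
  also have "\<dots> = (\<Sum>x\<in>B. \<bar>b x\<bar>)" by (rule sum.reindex_bij_betw[OF yB])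
  finally show ?thesis using 1 y(1) by blast
qed

section \<open>Optimality\<close>

theorem theorem2p1:
  fixes X :: "(real ^ 'k) set" and c :: "real ^ 'k" and xs :: "nat \<Rightarrow> real ^ 'k"
  assumes "compact X" and "completable X" and "c \<noteq> 0"
    and "xs \<in> indep_points X CARD('k)"
    and "\<forall>x \<in> indep_points X CARD('k). phi c x \<le> phi c xs"
  shows "c_optimal X c (xi_star X c CARD('k) xs)"
proof -
  \<comment> \<open>maximizing \<open>phi\<close> amounts to minimizing the \<open>\<ell>\<^sub>1\<close> norm of the coordinates of \<open>c\<close>\<close>
  have phi: "phi c x = (norm c / (\<Sum>i=1..CARD('k). \<bar>a i\<bar>))\<^sup>2"
    if "x \<in> indep_points X CARD('k)" "c = (\<Sum>i=1..CARD('k). a i *\<^sub>R x i)" for x a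
    using that z_star_eq[of "CARD('k)" x c a]
    by (simp add: phi_def indep_points_def power_divide)
  obtain a where a: "c = (\<Sum>i=1..CARD('k). a i *\<^sub>R xs i)"
    using lin_indep_basis_coeffs[of xs c] assms(4) by (auto simp: indep_points_def)
  let ?A = "\<Sum>i=1..CARD('k). \<bar>a i\<bar>"
  have A: "?A > 0" by (rule sum_abs_coeffs_pos[OF a assms(3)])
  have "Psi c (xi_star X c CARD('k) xs) \<le> Psi c \<eta>" if \<eta>: "\<eta> \<in> Xi X c" for \<eta>
  proof -
    obtain B b where B: "finite B" "B \<subseteq> X" "independent B" "c = (\<Sum>x\<in>B. b x *\<^sub>R x)"
      and b: "(\<Sum>x\<in>B. \<bar>b x\<bar>)\<^sup>2 \<le> Psi c \<eta>"
      using independent_representation_le_Psi[OF assms(1) \<eta> assms(3)] by blast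
    obtain y a' where y: "y \<in> indep_points X CARD('k)" "c = (\<Sum>i=1..CARD('k). a' i *\<^sub>R y i)"
      and a': "(\<Sum>i=1..CARD('k). \<bar>a' i\<bar>) = (\<Sum>x\<in>B. \<bar>b x\<bar>)"
      using complete_representation[OF assms(2) B assms(3)] by blast
    let ?A' = "\<Sum>i=1..CARD('k). \<bar>a' i\<bar>"
    have A': "?A' > 0" by (rule sum_abs_coeffs_pos[OF y(2) assms(3)])
    have "(norm c / ?A')\<^sup>2 \<le> (norm c / ?A)\<^sup>2"
      using assms(5) y(1) phi[OF y] phi[OF assms(4) a] by metis
    then have "norm c / ?A' \<le> norm c / ?A"
      by (rule power2_le_imp_le) (use A in simp)
    then have "?A \<le> ?A'"
      using divide_strict_left_mono[of ?A' ?A "norm c"] A A' assms(3)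
      by (metis mult_pos_pos not_le zero_less_norm_iff)
    then have "?A\<^sup>2 \<le> ?A'\<^sup>2" using A by (intro power_mono) auto
    then show ?thesis
      using b unfolding xi_star_in_Xi_Psi(2)[OF assms(1,4) a assms(3)] a' by (rule order_trans)
  qed
  then show ?thesis
    using xi_star_in_Xi_Psi(1)[OF assms(1,4) a assms(3)] by (simp add: c_optimal_def)
qed

end
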